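(* Let $x\in\Sigma$, and let $\ell_1,\ell_2,\dots$ and $m_0,m_1,m_2,\dots$ respectively be the lengths of the blocks of zeros and of ones in the block decomposition of $x$. Then the following conditions (i), (ii) and (iii) are equivalent. (i) $x$ is simply normal. (ii) $\displaystyle\lim_{j\to\infty}\frac{\ell_1+\cdots+\ell_j}{m_1+\cdots+m_j}=1$ and $\displaystyle\lim_{j\to\infty}\frac{\ell_j}{\ell_1+\cdots+\ell_{j-1}}=0$. (iii) $\displaystyle\lim_{j\to\infty}\frac{\ell_1+\cdots+\ell_j}{m_1+\cdots+m_j}=1$ and $\displaystyle\lim_{j\to\infty}\frac{m_j}{m_1+\cdots+m_{j-1}}=0$. Furthermore, the following statements (iv) and (v) hold. (iv) If $x$ is simply normal, the block decomposition of $x$ is regular. (v) When $p>0$, $x$ is simply normal, and $\Phi_2:\mathbb N\to(0,\infty)$ is the function associated with $p$ and $x$, there are $d_1,d_2>0$ such that $$d_1\Phi_2(n)\le\frac1n\left(\sum_{k=1}^n\frac1{f^{k-1}(x)^p}\right)\le d_2\Phi_2(n)\quad\text{for all }n\in\mathbb N.$$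
   Context: $\mathbb N=\{1,2,3,\dots\}$. The map $f:[0,1)\to[0,1)$ is $f(x)=2x$ if $0\le x<1/2$ and $f(x)=2x-1$ if $1/2\le x<1$; $f^k$ is the $k$-fold composition, $f^0(x)=x$. $\Sigma$ is the set of $x\in[0,1)$ that are not binary rationals (a binary rational is $0$ or a number $k/2^n$ with $k,n\in\mathbb N$, $1\le k<2^n$). Each $x\in\Sigma$ has a unique binary expansion $x=\sum_{k\ge1}d_k/2^k$, $d_k\in\{0,1\}$, and its digits are neither eventually all $0$ nor eventually all $1$. $x\in\Sigma$ is simply normal (to base 2) if $\lim_{n\to\infty}\frac1n|\{k:1\le k\le n,\ d_k=0\}|=\frac12$ and $\lim_{n\to\infty}\frac1n|\{k:1\le k\le n,\ d_k=1\}|=\frac12$. Block decomposition: for $x\in\Sigma$ the digit sequence $d_1d_2d_3\dots$ is written uniquely as juxtaposed finite blocks $C_0B_1C_1B_2C_2\cdots$, where each $B_j$ ($j\ge1$) is a non-empty block of zeros, each $C_j$ ($j\ge1$) is a non-empty block of ones, and $C_0$ is a (possibly empty) block of ones. Let $\ell_j\ge1$ be the length of $B_j$ ($j\ge1$) and $m_j$ the length of $C_j$ ($j\ge0$), so $m_j\ge1$ for $j\ge1$ and $m_0\ge0$. Let $J_j\subset\mathbb N$ be the set of positions occupied by $B_j$ and $K_j$ the set of positions occupied by $C_j$: with $s_0=0$, $t_0=m_0$, $s_j=t_{j-1}+\ell_j$, $t_j=s_j+m_j$ for $j\ge1$, one has $J_j=\{t_{j-1}+1,\dots,s_j\}$ for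 $j\ge 1$ and $K_j=\{s_j+1,\dots,t_j\}$ for $j\ge0$ ($K_0=\emptyset$ if $C_0$ is empty). The sets $K_0,J_1,K_1,J_2,K_2,\dots$ partition $\mathbb N$. Definition of $\Phi_2$: if $n\in K_0\cup J_1\cup K_1$, $\Phi_2(n)=1$. If $n\in J_j$ with $j\ge2$, $$\Phi_2(n)=\frac{\sum_{u=1}^j2^{p\ell_u}+\sum_{u=1}^{j-1}m_u}{\sum_{u=1}^j\ell_u+\sum_{u=1}^{j-1}m_u}.$$ If $n\in K_j$ with $j\ge2$, $$\Phi_2(n)=\frac{\sum_{u=1}^j2^{p\ell_u}+\sum_{u=1}^{j-1}m_u}{\sum_{u=1}^j\ell_u+\sum_{u=1}^{j}m_u}.$$ The block decomposition of $x\in\Sigma$ is called regular if there is $C>0$ such that for all $j\ge2$, $$\max\left(\frac{\ell_j}{\sum_{u=1}^{j-1}\ell_u+\sum_{u=1}^{j-1}m_u},\ \frac{m_j}{\sum_{u=1}^{j}\ell_u+\sum_{u=1}^{j-1}m_u}\right)\le C.$$ *)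

theory Defs
  imports Complex_Main
begin

definition doubling_map :: "real \<Rightarrow> real" where
  "doubling_map x = (if x < 1/2 then 2 * x else 2 * x - 1)"

definition binary_rational :: "real \<Rightarrow> bool" where
  "binary_rational x \<longleftrightarrow> x = 0 \<or>
     (\<exists>k n :: nat. 1 \<le> k \<and> 1 \<le> n \<and> k < 2 ^ n \<and> x = real k / 2 ^ n)"

definition Sigma_set :: "real set" where
  "Sigma_set = {x. 0 \<le> x \<and> x < 1 \<and> \<not> binary_rational x}"

(* Digits are indexed from 1; position 0 is unused and pinned to 0 so that the digit
   function is unique (see ex1_binary_expansion). *)
definition binary_expansion :: "real \<Rightarrow> (nat \<Rightarrow> nat) \<Rightarrow> bool" where
  "binary_expansion x d \<longleftrightarrow> d 0 = 0 \<and> (\<forall>k\<ge>1. d k \<in> {0, 1}) \<and>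
     (\<lambda>k. real (d (Suc k)) / 2 ^ Suc k) sums x"

definition binary_digit :: "real \<Rightarrow> nat \<Rightarrow> nat" where
  "binary_digit x = (THE d. binary_expansion x d)"

definition simply_normal :: "real \<Rightarrow> bool" where
  "simply_normal x \<longleftrightarrow>
     (\<lambda>n. real (card {k. 1 \<le> k \<and> k \<le> n \<and> binary_digit x k = 0}) / real n)
        \<longlonglongrightarrow> 1/2 \<and>
     (\<lambda>n. real (card {k. 1 \<le> k \<and> k \<le> n \<and> binary_digit x k = 1}) / real n)
        \<longlonglongrightarrow> 1/2"

(* Throughout, l and m are the lengths of the blocks of zeros (indexed from 1; the value l 0
   is never used) and of ones (indexed from 0). The last positions of the j-th blocks of
   zeros and of ones are block_s l m j and block_t l m j. *)
fun block_s :: "(nat \<Rightarrow> nat) \<Rightarrow> (nat \<Rightarrow> nat) \<Rightarrow> nat \<Rightarrow> nat"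
  and block_t :: "(nat \<Rightarrow> nat) \<Rightarrow> (nat \<Rightarrow> nat) \<Rightarrow> nat \<Rightarrow> nat" where
  "block_s l m 0 = 0"
| "block_s l m (Suc j) = block_t l m j + l (Suc j)"
| "block_t l m 0 = m 0"
| "block_t l m (Suc j) = block_s l m (Suc j) + m (Suc j)"

(* Only meant for j \<ge> 1. *)
definition zero_positions :: "(nat \<Rightarrow> nat) \<Rightarrow> (nat \<Rightarrow> nat) \<Rightarrow> nat \<Rightarrow> nat set" where
  "zero_positions l m j = {block_t l m (j - 1) + 1 .. block_s l m j}"

definition one_positions :: "(nat \<Rightarrow> nat) \<Rightarrow> (nat \<Rightarrow> nat) \<Rightarrow> nat \<Rightarrow> nat set" where
  "one_positions l m j = {block_s l m j + 1 .. block_t l m j}"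

definition block_decomposition :: "real \<Rightarrow> (nat \<Rightarrow> nat) \<Rightarrow> (nat \<Rightarrow> nat) \<Rightarrow> bool" where
  "block_decomposition x l m \<longleftrightarrow>
     (\<forall>j\<ge>1. 1 \<le> l j) \<and> (\<forall>j\<ge>1. 1 \<le> m j) \<and>
     (\<forall>j\<ge>1. \<forall>k\<in>zero_positions l m j. binary_digit x k = 0) \<and>
     (\<forall>j. \<forall>k\<in>one_positions l m j. binary_digit x k = 1)"

definition regular_blocks :: "(nat \<Rightarrow> nat) \<Rightarrow> (nat \<Rightarrow> nat) \<Rightarrow> bool" where
  "regular_blocks l m \<longleftrightarrow> (\<exists>C>0. \<forall>j\<ge>2.
     max (real (l j) / ((\<Sum>u=1..j-1. real (l u)) + (\<Sum>u=1..j-1. real (m u))))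
         (real (m j) / ((\<Sum>u=1..j. real (l u)) + (\<Sum>u=1..j-1. real (m u)))) \<le> C)"

(* The position sets partition the positive integers, so the block index chosen by THE is
   unique; the value at n = 0 is irrelevant. *)
definition Phi2 :: "real \<Rightarrow> (nat \<Rightarrow> nat) \<Rightarrow> (nat \<Rightarrow> nat) \<Rightarrow> nat \<Rightarrow> real" where
  "Phi2 p l m n =
     (if n \<in> one_positions l m 0 \<union> zero_positions l m 1 \<union> one_positions l m 1 then 1
      else if \<exists>j\<ge>2. n \<in> zero_positions l m j then
        (let j = (THE j. 2 \<le> j \<and> n \<in> zero_positions l m j) in
          ((\<Sum>u=1..j. 2 powr (p * real (l u))) + (\<Sum>u=1..j-1. real (m u))) /
          ((\<Sum>u=1..j. real (l u)) + (\<Sum>u=1..j-1. real (m u))))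
      else
        (let j = (THE j. 2 \<le> j \<and> n \<in> one_positions l m j) in
          ((\<Sum>u=1..j. 2 powr (p * real (l u))) + (\<Sum>u=1..j-1. real (m u))) /
          ((\<Sum>u=1..j. real (l u)) + (\<Sum>u=1..j. real (m u)))))"


text \<open>Expansions and block decompositions exist for every point of \<open>Sigma_set\<close>,
  and the expansion is unique.\<close>

lemma Sigma_set_not_int:
  assumes x: "x \<in> Sigma_set" shows "2 ^ n * x \<noteq> of_int z"
proof
  assume eq: "2 ^ n * x = of_int z"
  from x have x01: "0 \<le> x" "x < 1" and nb: "\<not> binary_rational x"
    by (auto simp: Sigma_set_def)
  have "x \<noteq> 0" using nb by (auto simp: binary_rational_def)
  with x01 have xp: "0 < x" by simp
  have "0 < 2 ^ n * x" using xp by simp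
  then have z0: "0 < z" using eq by simp
  have "2 ^ n * x < 2 ^ n" using x01 by simp
  then have "real_of_int z < of_int (2 ^ n)" using eq by simp
  then have zl: "z < 2 ^ n" by (simp only: of_int_less_iff)
  have n1: "1 \<le> n" using z0 zl by (cases n) auto
  have zk: "2 ^ n * x = real (nat z)" using eq z0 by simp
  have "nat z < 2 ^ n" using z0 zl by (simp add: nat_less_iff)
  moreover have "1 \<le> nat z" using z0 by simp
  moreover have "x = real (nat z) / 2 ^ n" by (simp only: zk[symmetric]) simp
  ultimately have "binary_rational x" unfolding binary_rational_def using n1 by blast
  with nb show False ..
qed

lemma binary_expansion_tail:
  assumes "binary_expansion x d"
  obtains N :: int where
    "(\<lambda>i. real (d (Suc (i + k))) / 2 ^ Suc i) sums (2 ^ k * x - of_int N)"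
proof -
  have s: "(\<lambda>k. real (d (Suc k)) / 2 ^ Suc k) sums x"
    using assms by (simp add: binary_expansion_def)
  define A where "A = (\<Sum>i<k. real (d (Suc i)) / 2 ^ Suc i)"
  have "(\<lambda>i. real (d (Suc (i + k))) / 2 ^ Suc (i + k)) sums (x - A)"
    using sums_split_initial_segment[OF s, of k] by (simp add: A_def)
  then have "(\<lambda>i. 2 ^ k * (real (d (Suc (i + k))) / 2 ^ Suc (i + k))) sums (2 ^ k * (x - A))"
    by (rule sums_mult)
  moreover have "(\<lambda>i. 2 ^ k * (real (d (Suc (i + k))) / 2 ^ Suc (i + k)))
      = (\<lambda>i. real (d (Suc (i + k))) / 2 ^ Suc i)"
    by (auto simp: power_add field_simps)
  moreover have "2 ^ k * A = of_int (\<Sum>i<k. int (d (Suc i)) * 2 ^ (k - Suc i))"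
  proof -
    have "2 ^ k * (real (d (Suc i)) / 2 ^ Suc i) = real (d (Suc i)) * 2 ^ (k - Suc i)"
      if "i < k" for i
    proof -
      have "(2::real) ^ k = 2 ^ (k - Suc i) * 2 ^ Suc i"
        using that by (metis Suc_leI le_add_diff_inverse2 power_add)
      then show ?thesis by simp
    qed
    then show ?thesis by (simp add: A_def sum_distrib_left)
  qed
  ultimately show ?thesis by (intro that) (simp only: right_diff_distrib)
qed

lemma sums_half: "(\<lambda>i. (1::real) / 2 ^ Suc i) sums 1"
  using power_half_series by (simp add: power_one_over)

lemma binary_expansion_digit:
  assumes x: "x \<in> Sigma_set" and d: "binary_expansion x d" and k: "1 \<le> k"
  shows "int (d k) = \<lfloor>2 ^ k * x\<rfloor> - 2 * \<lfloor>2 ^ (k - 1) * x\<rfloor>"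
proof -
  have dk: "d i \<le> 1" for i
    using d by (cases "i = 0") (auto simp: binary_expansion_def dest: spec[of _ i])
  have fl: "(\<lambda>i. real (d (Suc (i + n))) / 2 ^ Suc i)
      sums (2 ^ n * x - of_int \<lfloor>2 ^ n * x\<rfloor>)" for n
  proof -
    obtain N where N: "(\<lambda>i. real (d (Suc (i + n))) / 2 ^ Suc i) sums (2 ^ n * x - of_int N)"
      using binary_expansion_tail[OF d] by blast
    have "0 \<le> 2 ^ n * x - of_int N"
      by (rule sums_le[OF _ sums_zero N]) simp
    moreover have "2 ^ n * x - of_int N \<le> 1"
      by (rule sums_le[OF _ N sums_half]) (use dk in \<open>simp add: divide_simps\<close>)
    moreover have "2 ^ n * x \<noteq> of_int (N + 1)" by (rule Sigma_set_not_int[OF x])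
    ultimately have "\<lfloor>2 ^ n * x\<rfloor> = N" by (intro floor_unique) auto
    with N show ?thesis by simp
  qed
  obtain n where n: "k = Suc n" using k by (cases k) auto
  define g where "g = (\<lambda>i. real (d (Suc (i + n))) / 2 ^ Suc i)"
  have "(\<lambda>i. g (Suc i)) sums (2 ^ n * x - of_int \<lfloor>2 ^ n * x\<rfloor> - g 0)"
    using fl[of n] sums_Suc_iff[of g "2 ^ n * x - of_int \<lfloor>2 ^ n * x\<rfloor> - g 0"]
    by (simp add: g_def)
  from sums_mult[OF this, of 2]
  have "(\<lambda>i. real (d (Suc (i + k))) / 2 ^ Suc i)
      sums (2 * (2 ^ n * x - of_int \<lfloor>2 ^ n * x\<rfloor> - g 0))"
    by (simp add: g_def n)
  with fl[of k] have "2 ^ k * x - of_int \<lfloor>2 ^ k * x\<rfloor>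
      = 2 * (2 ^ n * x - of_int \<lfloor>2 ^ n * x\<rfloor> - g 0)"
    using sums_unique2 by blast
  then have "real (d k) = of_int (\<lfloor>2 ^ k * x\<rfloor> - 2 * \<lfloor>2 ^ n * x\<rfloor>)"
    by (simp add: g_def n algebra_simps)
  then have "real_of_int (int (d k)) = of_int (\<lfloor>2 ^ k * x\<rfloor> - 2 * \<lfloor>2 ^ n * x\<rfloor>)"
    by simp
  then have "int (d k) = \<lfloor>2 ^ k * x\<rfloor> - 2 * \<lfloor>2 ^ n * x\<rfloor>"
    by (simp only: of_int_eq_iff)
  then show ?thesis by (simp add: n)
qed

lemma ex1_binary_expansion:
  assumes x: "x \<in> Sigma_set"
  shows "\<exists>!d. binary_expansion x d"
proof (rule ex_ex1I)
  have x01: "0 \<le> x" "x < 1" using x by (auto simp: Sigma_set_def)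
  define F where "F = (\<lambda>n. \<lfloor>2 ^ n * x\<rfloor>)"
  define d where "d = (\<lambda>k. if k = 0 then 0 else nat (F k - 2 * F (k - 1)))"
  have dF: "F (Suc n) - 2 * F n \<in> {0, 1}" for n
  proof -
    have "of_int (F n) \<le> 2 ^ n * x" "2 ^ n * x < of_int (F n) + 1"
      "of_int (F (Suc n)) \<le> 2 * (2 ^ n * x)" "2 * (2 ^ n * x) < of_int (F (Suc n)) + 1"
      by (auto simp: F_def mult.assoc)
    then have "real_of_int (F (Suc n)) < of_int (2 * F n + 2)"
      and "real_of_int (2 * F n) < of_int (F (Suc n) + 1)" by simp_all
    then have "F (Suc n) < 2 * F n + 2" "2 * F n < F (Suc n) + 1"
      by (simp_all only: of_int_less_iff)
    then show ?thesis by auto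
  qed
  have rd: "real (d (Suc n)) = of_int (F (Suc n)) - 2 * of_int (F n)" for n
    using dF[of n] by (auto simp: d_def)
  have part: "(\<Sum>i<n. real (d (Suc i)) / 2 ^ Suc i) = of_int (F n) / 2 ^ n" for n
  proof (induction n)
    case 0
    have "F 0 = 0" using x01 by (simp add: F_def floor_eq_iff)
    then show ?case by simp
  next
    case (Suc n)
    then show ?case by (simp add: rd field_simps)
  qed
  have "(\<lambda>n. of_int (F n) / 2 ^ n) \<longlonglongrightarrow> x"
  proof (rule tendsto_sandwich[of "\<lambda>n. x - (1/2) ^ n" _ _ "\<lambda>_. x"])
    show "\<forall>\<^sub>F n in sequentially. x - (1/2) ^ n \<le> of_int (F n) / 2 ^ n"
    proof (intro always_eventually allI)
      fix n
      have "2 ^ n * x - 1 \<le> of_int (F n)" unfolding F_def by linarith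
      then have "(2 ^ n * x - 1) / 2 ^ n \<le> of_int (F n) / 2 ^ n"
        by (rule divide_right_mono) simp
      then show "x - (1/2) ^ n \<le> of_int (F n) / 2 ^ n"
        by (simp add: diff_divide_distrib power_one_over)
    qed
    show "\<forall>\<^sub>F n in sequentially. of_int (F n) / 2 ^ n \<le> x"
      by (intro always_eventually allI) (simp add: F_def field_simps)
    show "(\<lambda>n. x - (1/2) ^ n) \<longlonglongrightarrow> x"
      using tendsto_diff[OF tendsto_const LIMSEQ_power_zero[of "1/2::real"], of x] by simp
  qed simp
  then have "(\<lambda>k. real (d (Suc k)) / 2 ^ Suc k) sums x"
    by (simp only: sums_def part)
  moreover have "d k \<in> {0, 1}" if "1 \<le> k" for k
    using dF[of "k - 1"] that by (auto simp: d_def)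
  ultimately have "binary_expansion x d" by (simp add: binary_expansion_def d_def)
  then show "\<exists>d. binary_expansion x d" by (rule exI[of _ d])
next
  fix d e assume d: "binary_expansion x d" and e: "binary_expansion x e"
  show "d = e"
  proof
    fix k show "d k = e k"
    proof (cases "k = 0")
      case True then show ?thesis using d e by (simp add: binary_expansion_def)
    next
      case False
      then have "1 \<le> k" by simp
      with binary_expansion_digit[OF x d this] binary_expansion_digit[OF x e this]
      show ?thesis by simp
    qed
  qed
qed

lemma binary_expansion_binary_digit:
  "x \<in> Sigma_set \<Longrightarrow> binary_expansion x (binary_digit x)"
  using theI'[OF ex1_binary_expansion] by (simp add: binary_digit_def)

lemma binary_digit_recurs:
  assumes x: "x \<in> Sigma_set" and c: "c \<in> {0, 1}"
  shows "\<exists>i\<ge>k. binary_digit x (Suc i) = c"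
proof (rule ccontr)
  assume neg: "\<not> ?thesis"
  note d = binary_expansion_binary_digit[OF x]
  have "binary_digit x (Suc (i + k)) = 1 - c" for i
  proof -
    have "binary_digit x (Suc (i + k)) \<in> {0, 1}"
      using d by (simp add: binary_expansion_def)
    moreover have "binary_digit x (Suc (i + k)) \<noteq> c" using neg by simp
    ultimately show ?thesis using c by auto
  qed
  moreover obtain N where
    "(\<lambda>i. real (binary_digit x (Suc (i + k))) / 2 ^ Suc i) sums (2 ^ k * x - of_int N)"
    using binary_expansion_tail[OF d] by blast
  ultimately have "(\<lambda>i. real (1 - c) * (1 / 2 ^ Suc i)) sums (2 ^ k * x - of_int N)"
    by simp
  moreover have "(\<lambda>i. real (1 - c) * (1 / 2 ^ Suc i)) sums (real (1 - c) * 1)"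
    by (rule sums_mult[OF sums_half])
  ultimately have "2 ^ k * x - of_int N = real (1 - c) * 1" by (rule sums_unique2)
  then have "2 ^ k * x = of_int (N + int (1 - c))" by simp
  then show False using Sigma_set_not_int[OF x] by blast
qed

lemma ex_block_decomposition:
  assumes x: "x \<in> Sigma_set"
  shows "\<exists>l m. block_decomposition x l m"
proof -
  let ?d = "binary_digit x"
  have d01: "?d (Suc k) \<in> {0, 1}" for k
    using binary_expansion_binary_digit[OF x] by (simp add: binary_expansion_def)
  define nxt where "nxt = (\<lambda>c a. LEAST i. a \<le> i \<and> ?d (Suc i) = c)"
  have nxt: "a \<le> nxt c a" "?d (Suc (nxt c a)) = c" if "c \<in> {0, 1}" for c a
  proof -
    have "\<exists>i. a \<le> i \<and> ?d (Suc i) = c" using binary_digit_recurs[OF x that] by blast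
    from LeastI_ex[OF this] show "a \<le> nxt c a" "?d (Suc (nxt c a)) = c"
      by (simp_all add: nxt_def)
  qed
  have run: "?d k = 1 - c" if "c \<in> {0, 1}" "k \<in> {a + 1 .. nxt c a}" for c a k
  proof -
    have "k \<noteq> 0" using that(2) by simp
    then obtain i where i: "k = Suc i" using not0_implies_Suc by blast
    then have "i < nxt c a" "a \<le> i" using that by auto
    then have "?d (Suc i) \<noteq> c" using not_less_Least[of i] by (auto simp: nxt_def)
    then show ?thesis using d01[of i] that(1) i by auto
  qed
  define T where "T = rec_nat (nxt 0 0) (\<lambda>_ t. nxt 0 (nxt 1 t))"
  have T0: "T 0 = nxt 0 0" and TS: "T (Suc j) = nxt 0 (nxt 1 (T j))" for j
    by (simp_all add: T_def)
  define l where "l = (\<lambda>j. nxt 1 (T (j - 1)) - T (j - 1))"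
  define m where "m = (\<lambda>j. if j = 0 then T 0 else T j - nxt 1 (T (j - 1)))"
  have lS: "l (Suc j) = nxt 1 (T j) - T j" and mS: "m (Suc j) = T (Suc j) - nxt 1 (T j)" for j
    by (simp_all add: l_def m_def)
  have T: "?d (Suc (T j)) = 0" for j by (cases j) (simp_all add: T0 TS nxt)
  have n1: "T j < nxt 1 (T j)" for j
    using nxt[of 1 "T j"] T[of j] by (cases "T j = nxt 1 (T j)") auto
  have n0: "nxt 1 (T j) < T (Suc j)" for j
    using nxt[of 0 "nxt 1 (T j)"] nxt[of 1 "T j"]
    by (cases "nxt 1 (T j) = T (Suc j)") (auto simp: TS)
  have bt: "block_t l m j = T j" for j
  proof (induction j)
    case (Suc j)
    then show ?case using n1[of j] n0[of j] by (simp add: lS mS)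
  qed (simp add: m_def)
  have bs: "block_s l m (Suc j) = nxt 1 (T j)" for j
    using n1[of j] by (simp add: bt lS)
  have "1 \<le> l j" if "1 \<le> j" for j using n1[of "j - 1"] by (simp add: l_def)
  moreover have "1 \<le> m j" if "1 \<le> j" for j using n0[of "j - 1"] that by (simp add: m_def)
  moreover have "?d k = 0" if "1 \<le> j" "k \<in> zero_positions l m j" for j k
  proof -
    have "j \<noteq> 0" using that(1) by simp
    then obtain i where "j = Suc i" using not0_implies_Suc by blast
    then have "k \<in> {T i + 1 .. nxt 1 (T i)}"
      using that unfolding zero_positions_def by (simp only: bt bs diff_Suc_1)
    then show ?thesis using run[of 1 k] by simp
  qed
  moreover have "?d k = 1" if "k \<in> one_positions l m j" for j k
  proof (cases j)
    case 0
    then have "k \<in> {0 + 1 .. nxt 0 0}"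
      using that unfolding one_positions_def by (simp add: bt T0 m_def)
    then show ?thesis using run[of 0 k 0] by simp
  next
    case (Suc i)
    then have "k \<in> {nxt 1 (T i) + 1 .. nxt 0 (nxt 1 (T i))}"
      using that unfolding one_positions_def by (simp only: bt bs TS)
    then show ?thesis using run[of 0 k] by simp
  qed
  ultimately show ?thesis unfolding block_decomposition_def by blast
qed

end

theory Submission
  imports Defs
begin

text \<open>Let \<open>L j\<close> and \<open>M j\<close> be the numbers of zeros and of ones in the first \<open>j\<close> blocks of each
  kind (not counting the ones of \<open>C\<^sub>0\<close>). Between two consecutive block ends the numbers of zeros
  and of ones are squeezed between their values at these ends, so simple normality only has to be
  tested at block ends, where it says that \<open>L j / M j\<close> and \<open>L (j + 1) / M j\<close> both tend to 1; each
  of (ii) and (iii) is a rewriting of this pair of limits, and regularity follows from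
  boundedness of convergent sequences.

  For the Birkhoff sums, \<open>f\<^sup>k\<^sup>-\<^sup>1(x)\<close> is \<open>2\<^sup>-\<^sup>r\<close> up to a factor 2 when exactly \<open>r\<close> zeros
  start at position \<open>k\<close>. A block of \<open>\<ell>\<close> zeros therefore contributes a geometric sum dominated by
  its first term \<open>2\<^bsup>p\<ell>\<^esup>\<close>, so that even a partially summed block has the full order of magnitude;
  regularity makes \<open>n\<close> comparable to the denominator of \<open>\<Phi>\<^sub>2(n)\<close>.\<close>

section \<open>Limits of ratios\<close>

lemma tendsto_mult_one_iff:
  fixes f g :: "nat \<Rightarrow> real"
  assumes f: "f \<longlonglongrightarrow> 1"
  shows "(\<lambda>j. f j * g j) \<longlonglongrightarrow> 1 \<longleftrightarrow> g \<longlonglongrightarrow> 1"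
proof
  assume "(\<lambda>j. f j * g j) \<longlonglongrightarrow> 1"
  from tendsto_divide[OF this f] have "(\<lambda>j. f j * g j / f j) \<longlonglongrightarrow> 1" by simp
  moreover have "\<forall>\<^sub>F j in sequentially. f j \<noteq> 0"
    by (rule tendsto_imp_eventually_ne[OF f]) simp
  then have "\<forall>\<^sub>F j in sequentially. f j * g j / f j = g j"
    by eventually_elim simp
  ultimately show "g \<longlonglongrightarrow> 1" by (rule Lim_transform_eventually)
next
  assume "g \<longlonglongrightarrow> 1"
  from tendsto_mult[OF f this] show "(\<lambda>j. f j * g j) \<longlonglongrightarrow> 1" by simp
qed

text \<open>Reciprocals turn the left side into \<open>c / A n + 1 + B n / A n\<close>, whose first
  term vanishes. In use, \<open>c\<close> is the length of the leading block of ones, which drops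
  out in the limit.\<close>

lemma tendsto_half_iff_ratio:
  fixes A B :: "nat \<Rightarrow> real"
  assumes A: "filterlim A at_top sequentially"
  shows "(\<lambda>n. A n / (c + A n + B n)) \<longlonglongrightarrow> 1/2 \<longleftrightarrow> (\<lambda>n. A n / B n) \<longlonglongrightarrow> 1"
proof -
  have pos: "\<forall>\<^sub>F n in sequentially. A n > 0"
    using A by (simp add: filterlim_at_top_dense)
  have c0: "(\<lambda>n. c / A n) \<longlonglongrightarrow> 0"
    by (rule tendsto_divide_0[OF tendsto_const filterlim_at_top_imp_at_infinity[OF A]])
  have eq: "\<forall>\<^sub>F n in sequentially. (c + A n + B n) / A n = c / A n + 1 + B n / A n"
    using pos by eventually_elim (simp add: add_divide_distrib)
  have "(\<lambda>n. A n / (c + A n + B n)) \<longlonglongrightarrow> 1/2 \<longleftrightarrow> (\<lambda>n. (c + A n + B n) / A n) \<longlonglongrightarrow> 2"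
    using tendsto_inverse[of "\<lambda>n. A n / (c + A n + B n)" "1/2" sequentially]
      tendsto_inverse[of "\<lambda>n. (c + A n + B n) / A n" 2 sequentially] by auto
  also have "\<dots> \<longleftrightarrow> (\<lambda>n. c / A n + 1 + B n / A n) \<longlonglongrightarrow> 2"
    by (rule tendsto_cong[OF eq])
  also have "\<dots> \<longleftrightarrow> (\<lambda>n. B n / A n) \<longlonglongrightarrow> 1"
  proof
    assume "(\<lambda>n. c / A n + 1 + B n / A n) \<longlonglongrightarrow> 2"
    from tendsto_diff[OF this tendsto_add[OF c0 tendsto_const[of 1]]]
    show "(\<lambda>n. B n / A n) \<longlonglongrightarrow> 1" by simp
  next
    assume "(\<lambda>n. B n / A n) \<longlonglongrightarrow> 1"
    from tendsto_add[OF tendsto_add[OF c0 tendsto_const[of 1]] this]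
    show "(\<lambda>n. c / A n + 1 + B n / A n) \<longlonglongrightarrow> 2" by simp
  qed
  also have "\<dots> \<longleftrightarrow> (\<lambda>n. A n / B n) \<longlonglongrightarrow> 1"
    using tendsto_inverse[of "\<lambda>n. A n / B n" 1 sequentially]
      tendsto_inverse[of "\<lambda>n. B n / A n" 1 sequentially] by auto
  finally show ?thesis .
qed

lemma sum_ge_index:
  fixes a :: "nat \<Rightarrow> nat"
  assumes "\<And>j. 1 \<le> j \<Longrightarrow> 1 \<le> a j"
  shows "real j \<le> (\<Sum>u=1..j. real (a u))"
proof -
  have "(\<Sum>u=1..j. 1) \<le> (\<Sum>u=1..j. real (a u))"
    by (intro sum_mono) (use assms in force)
  then show ?thesis by simp
qed

text \<open>With \<open>s j\<close> the partial sums,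
  \<open>s (Suc j) / s j = 1 + a (Suc j) / s j\<close> once \<open>s j\<close> is positive. This
  gives the second limits in (ii) and (iii) the shape of a ratio tending to 1.\<close>

lemma increment_ratio_iff:
  fixes a :: "nat \<Rightarrow> nat"
  assumes a: "\<And>j. 1 \<le> j \<Longrightarrow> 1 \<le> a j"
  shows "(\<lambda>j. real (a j) / (\<Sum>u=1..j-1. real (a u))) \<longlonglongrightarrow> 0 \<longleftrightarrow>
    (\<lambda>j. (\<Sum>u=1..Suc j. real (a u)) / (\<Sum>u=1..j. real (a u))) \<longlonglongrightarrow> 1"
proof -
  define s where "s j = (\<Sum>u=1..j. real (a u))" for j
  have "\<forall>\<^sub>F j in sequentially. s (Suc j) / s j = real (a (Suc j)) / s j + 1"
    using eventually_ge_at_top[of 1]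
  proof eventually_elim
    case (elim j)
    then have "s j > 0" using sum_ge_index[of a j] a by (simp add: s_def)
    then show ?case by (simp add: s_def add_divide_distrib)
  qed
  then have "(\<lambda>j. s (Suc j) / s j) \<longlonglongrightarrow> 1 \<longleftrightarrow> (\<lambda>j. real (a (Suc j)) / s j + 1) \<longlonglongrightarrow> 1"
    by (rule tendsto_cong)
  also have "\<dots> \<longleftrightarrow> (\<lambda>j. real (a (Suc j)) / s j) \<longlonglongrightarrow> 0"
    using tendsto_add_const_iff[of 1 "\<lambda>j. real (a (Suc j)) / s j" 0 sequentially]
    by (simp add: add.commute)
  also have "\<dots> \<longleftrightarrow> (\<lambda>j. real (a j) / s (j - 1)) \<longlonglongrightarrow> 0"
    using filterlim_sequentially_Suc[of "\<lambda>j. real (a j) / s (j - 1)"] by simp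
  finally show ?thesis by (simp add: s_def)
qed

text \<open>Meant for \<open>A\<close> the Birkhoff sum and \<open>N / D\<close> the fraction
  defining \<open>Phi2\<close>: numerators and denominators are compared separately.\<close>

lemma ratio_comparison:
  fixes A N D n c C Q :: real
  assumes "0 < n" "0 < D" "0 < c" "0 < C" "0 \<le> N"
    and "D \<le> C * n" "n \<le> c * D" "N \<le> A" "A \<le> Q * N"
  shows "1 / c * (N / D) \<le> A / n" "A / n \<le> Q * C * (N / D)"
proof -
  have "1 / c * (N / D) = N / (c * D)" by simp
  also have "\<dots> \<le> A / n" by (rule frac_le) (use assms in auto)
  finally show "1 / c * (N / D) \<le> A / n" .
  have "A / n \<le> (Q * N) / (D / C)"
    by (rule frac_le) (use assms in \<open>auto simp: field_simps\<close>)
  then show "A / n \<le> Q * C * (N / D)" by (simp add: algebra_simps)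
qed

lemma sum_atLeast1_split:
  fixes g :: "nat \<Rightarrow> real"
  assumes "a \<le> b"
  shows "(\<Sum>k=1..b. g k) = (\<Sum>k=1..a. g k) + (\<Sum>k=a+1..b. g k)"
  using sum.ub_add_nat[of 1 a g "b - a"] assms by simp

text \<open>\<open>2 powr p\<close> times the sum of the geometric series of ratio
  \<open>2 powr (- p)\<close>. It bounds a block of zeros relative to its first term and also
  exceeds the bound \<open>2 powr p\<close> for a single one, so it serves both kinds of
  block.\<close>

definition zero_const :: "real \<Rightarrow> real" where
  "zero_const p = 2 powr p / (1 - 2 powr (- p))"

lemma zero_const_ge:
  assumes "0 < p" shows "2 powr p \<le> zero_const p" "1 \<le> zero_const p"
proof -
  have q: "0 < 2 powr (- p)" "2 powr (- p) < (1::real)" using assms by (simp_all add: powr_less_one)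
  then show "2 powr p \<le> zero_const p"
    unfolding zero_const_def by (simp add: le_divide_eq)
  moreover have "1 \<le> 2 powr p" using assms by (simp add: ge_one_powr_ge_zero)
  ultimately show "1 \<le> zero_const p" by linarith
qed

lemma geometric_powr_bound:
  assumes p: "0 < p"
  shows "(\<Sum>i<n. 2 powr p * 2 powr (p * real (n - i))) \<le> zero_const p * 2 powr (p * real n)"
proof -
  define q where "q = (2::real) powr (- p)"
  have q: "0 < q" "q < 1" using p by (simp_all add: q_def powr_less_one)
  have "2 powr (p * real (n - i)) = 2 powr (p * real n) * q ^ i" if "i < n" for i
    using that by (simp add: q_def powr_power powr_add[symmetric] of_nat_diff algebra_simps)
  then have "(\<Sum>i<n. 2 powr p * 2 powr (p * real (n - i)))
      = 2 powr p * 2 powr (p * real n) * (\<Sum>i<n. q ^ i)"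
    by (simp add: sum_distrib_left mult.assoc)
  also have "(\<Sum>i<n. q ^ i) \<le> 1 / (1 - q)"
    using q by (simp add: sum_gp_strict divide_right_mono)
  finally show ?thesis
    by (simp add: zero_const_def q_def mult_left_mono mult.commute)
qed

section \<open>Orbits of the doubling map\<close>

text \<open>Doubling commutes with taking fractional parts; the two branches of the map are the
  cases where the integer part of \<open>2 * y\<close> is even or odd. The closed form links orbits
  to the floor formula for digits.\<close>

lemma doubling_map_funpow:
  assumes "0 \<le> x" "x < 1"
  shows "(doubling_map ^^ k) x = frac (2 ^ k * x)"
proof (induction k)
  case 0
  then show ?case using assms by (simp add: frac_eq)
next
  case (Suc k)
  have "doubling_map (frac y) = frac (2 * y)" for y
  proof (cases "frac y < 1/2")
    case True
    then have "\<lfloor>2 * y\<rfloor> = 2 * \<lfloor>y\<rfloor>" unfolding frac_def by linarith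
    then show ?thesis using True by (simp add: doubling_map_def frac_def)
  next
    case False
    then have "\<lfloor>2 * y\<rfloor> = 2 * \<lfloor>y\<rfloor> + 1" unfolding frac_def by linarith
    then show ?thesis using False by (simp add: doubling_map_def frac_def)
  qed
  then show ?case by (simp add: Suc mult.assoc)
qed

section \<open>Block ends and the location of a position among the blocks\<close>

locale block_decomposed =
  fixes x :: real and l m :: "nat \<Rightarrow> nat"
  assumes x: "x \<in> Sigma_set" and blocks: "block_decomposition x l m"
begin

abbreviation "orbit k \<equiv> (doubling_map ^^ k) x"
abbreviation "S \<equiv> block_s l m"
abbreviation "T \<equiv> block_t l m"

definition L :: "nat \<Rightarrow> real" where "L j = (\<Sum>u=1..j. real (l u))"
definition M :: "nat \<Rightarrow> real" where "M j = (\<Sum>u=1..j. real (m u))"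

lemma l_ge_1: "1 \<le> j \<Longrightarrow> 1 \<le> l j" and m_ge_1: "1 \<le> j \<Longrightarrow> 1 \<le> m j"
  using blocks by (auto simp: block_decomposition_def)

lemma digit_zero: "k \<in> {T j + 1..S (Suc j)} \<Longrightarrow> binary_digit x k = 0"
  using blocks unfolding block_decomposition_def zero_positions_def
  by (metis diff_Suc_1 le_add1 plus_1_eq_Suc)

lemma digit_one: "k \<in> {S j + 1..T j} \<Longrightarrow> binary_digit x k = 1"
  using blocks unfolding block_decomposition_def one_positions_def by blast

lemma digit_01: "1 \<le> k \<Longrightarrow> binary_digit x k \<in> {0, 1}"
  using binary_expansion_binary_digit[OF x] by (simp add: binary_expansion_def)

lemma L_0 [simp]: "L 0 = 0" and M_0 [simp]: "M 0 = 0"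
  and L_Suc: "L (Suc j) = L j + real (l (Suc j))" and M_Suc: "M (Suc j) = M j + real (m (Suc j))"
  by (simp_all add: L_def M_def)

lemma L_ge: "real j \<le> L j" and M_ge: "real j \<le> M j"
  unfolding L_def M_def by (intro sum_ge_index l_ge_1 m_ge_1; assumption)+

lemma real_T: "real (T j) = real (m 0) + L j + M j"
  by (induction j) (simp_all add: L_Suc M_Suc)

lemma real_S: "real (S (Suc j)) = real (m 0) + L (Suc j) + M j"
  by (simp add: real_T L_Suc)

lemma T_less_S: "T j < S (Suc j)" and S_less_T: "S (Suc j) < T (Suc j)"
  using l_ge_1[of "Suc j"] m_ge_1[of "Suc j"] by simp_all

lemma strict_mono_T: "strict_mono T"
  unfolding strict_mono_Suc_iff using T_less_S S_less_T less_trans by blast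

text \<open>The positions from \<open>T j + 1\<close> to \<open>T (Suc j)\<close> hold one block of
  zeros followed by one of ones; strict monotonicity of \<open>T\<close> keeps these intervals
  disjoint.\<close>

lemma T_between_unique:
  assumes "T i < n" "n \<le> T (Suc i)" "T j < n" "n \<le> T (Suc j)"
  shows "i = j"
proof -
  have "T i < T (Suc j)" "T j < T (Suc i)" using assms by linarith+
  then show ?thesis using strict_mono_less[OF strict_mono_T] by (simp del: block_t.simps)
qed

lemma ex_T_between:
  assumes "T i < n"
  shows "\<exists>j\<ge>i. T j < n \<and> n \<le> T (Suc j)"
proof -
  define j where "j = (LEAST j. n \<le> T (Suc j))"
  \<comment> \<open>A strictly increasing sequence of naturals dominates its index, so the set whose
    least element is taken is non-empty.\<close>
  have "n \<le> T n" by (rule strict_mono_imp_increasing[OF strict_mono_T])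
  also have "\<dots> \<le> T (Suc n)" using strict_mono_less_eq[OF strict_mono_T] by simp
  finally have j: "n \<le> T (Suc j)" unfolding j_def by (rule LeastI)
  then have "T i < T (Suc j)" using assms by linarith
  then have "i \<le> j" using strict_mono_less[OF strict_mono_T] by (simp del: block_t.simps)
  moreover have "T j < n"
  proof (cases j)
    case 0 then show ?thesis using assms \<open>i \<le> j\<close> by simp
  next
    case (Suc k)
    then have "\<not> n \<le> T (Suc k)" unfolding j_def by (intro not_less_Least) simp
    then show ?thesis using Suc by (simp del: block_t.simps)
  qed
  ultimately show ?thesis using j by blast
qed

text \<open>Put \<open>y = 2 ^ k * x\<close>. Positivity holds because \<open>y\<close> is not an
  integer; the digit is the integer part of \<open>2 * y\<close> minus twice that of
  \<open>y\<close>, which vanishes exactly when the fractional part of \<open>y\<close> is below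
  1/2.\<close>

lemma orbit_pos: "0 < orbit k" and orbit_less_1: "orbit k < 1"
  and digit_zero_iff: "binary_digit x (Suc k) = 0 \<longleftrightarrow> orbit k < 1/2"
proof -
  have x01: "0 \<le> x" "x < 1" using x by (auto simp: Sigma_set_def)
  note orb = doubling_map_funpow[OF x01, of k]
  have "2 ^ k * x \<notin> \<int>" using Sigma_set_not_int[OF x] by (auto elim: Ints_cases)
  then show "0 < orbit k" unfolding orb by (simp add: frac_gt_0_iff)
  show "orbit k < 1" unfolding orb by (rule frac_lt_1)
  have "int (binary_digit x (Suc k)) = \<lfloor>2 * (2 ^ k * x)\<rfloor> - 2 * \<lfloor>2 ^ k * x\<rfloor>"
    using binary_expansion_digit[OF x binary_expansion_binary_digit[OF x], of "Suc k"]
    by (simp add: mult.assoc)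
  then show "binary_digit x (Suc k) = 0 \<longleftrightarrow> orbit k < 1/2"
    unfolding orb frac_def by linarith
qed

lemma orbit_zeros:
  assumes "\<And>i. i < r \<Longrightarrow> binary_digit x (Suc (k + i)) = 0"
  shows "orbit (k + r) = 2 ^ r * orbit k"
  using assms
proof (induction r)
  case (Suc r)
  have "orbit (k + r) < 1/2" using Suc.prems[of r] digit_zero_iff[of "k + r"] by blast
  then have "orbit (k + Suc r) = 2 * orbit (k + r)" by (simp add: doubling_map_def)
  moreover have "orbit (k + r) = 2 ^ r * orbit k" using Suc by simp
  ultimately show ?case by simp
qed simp

section \<open>Simple normality\<close>

definition Z :: "nat \<Rightarrow> real" where "Z n = (\<Sum>k=1..n. of_bool (binary_digit x k = 0))"

lemma card_digit:
  "real (card {k. 1 \<le> k \<and> k \<le> n \<and> binary_digit x k = c})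
    = (\<Sum>k=1..n. of_bool (binary_digit x k = c))"
proof -
  have "{k. 1 \<le> k \<and> k \<le> n \<and> binary_digit x k = c} = {1..n} \<inter> {k. binary_digit x k = c}"
    by auto
  then show ?thesis by (simp add: of_bool_def sum.If_cases)
qed

lemma card_ones:
  "real (card {k. 1 \<le> k \<and> k \<le> n \<and> binary_digit x k = 1}) = real n - Z n"
proof -
  have "(\<Sum>k=1..n. of_bool (binary_digit x k = 1))
      = (\<Sum>k=1..n. 1 - of_bool (binary_digit x k = 0) :: real)"
    by (rule sum.cong) (use digit_01 in force)+
  also have "\<dots> = real n - Z n" unfolding Z_def sum_subtractf by simp
  finally show ?thesis by (simp only: card_digit)
qed

text \<open>The two digit frequencies add up to 1 for \<open>n > 0\<close>, so the one for zeros
  determines the other.\<close>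

lemma simply_normal_iff: "simply_normal x \<longleftrightarrow> (\<lambda>n. Z n / real n) \<longlonglongrightarrow> 1/2"
proof -
  have "(\<lambda>n. (real n - Z n) / real n) \<longlonglongrightarrow> 1/2" if "(\<lambda>n. Z n / real n) \<longlonglongrightarrow> 1/2"
  proof -
    have "(\<lambda>n. 1 - Z n / real n) \<longlonglongrightarrow> 1/2"
      using tendsto_diff[OF tendsto_const[of 1] that] by simp
    moreover have "\<forall>\<^sub>F n in sequentially. 1 - Z n / real n = (real n - Z n) / real n"
      using eventually_gt_at_top[of 0] by eventually_elim (simp add: diff_divide_distrib)
    ultimately show ?thesis by (rule Lim_transform_eventually)
  qed
  then show ?thesis
    unfolding simply_normal_def card_ones by (auto simp only: card_digit Z_def)
qed

lemma Z_mono: "a \<le> b \<Longrightarrow> Z a \<le> Z b"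
  unfolding Z_def by (rule sum_mono2) auto

lemma ones_mono: "a \<le> b \<Longrightarrow> real a - Z a \<le> real b - Z b"
  unfolding card_ones[symmetric] of_nat_le_iff by (rule card_mono) auto

lemma Z_S_Suc: "Z (S (Suc j)) = Z (T j) + real (l (Suc j))"
proof -
  have "(\<Sum>k=T j+1..S (Suc j). of_bool (binary_digit x k = 0) :: real) = (\<Sum>k=T j+1..S (Suc j). 1)"
    by (rule sum.cong) (use digit_zero in auto)
  then show ?thesis
    unfolding Z_def using sum_atLeast1_split[OF less_imp_le[OF T_less_S]] by simp
qed

lemma Z_T: "Z (T j) = Z (S j)"
proof -
  have "S j \<le> T j" by (cases j) simp_all
  moreover have "(\<Sum>k=S j+1..T j. of_bool (binary_digit x k = 0) :: real) = (\<Sum>k=S j+1..T j. 0)"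
    by (rule sum.cong) (use digit_one in auto)
  ultimately show ?thesis unfolding Z_def by (subst sum_atLeast1_split[of "S j"]) simp_all
qed

lemma Z_S: "Z (S j) = L j"
proof (induction j)
  case 0
  then show ?case by (simp add: Z_def)
next
  case (Suc j)
  then show ?case by (simp only: Z_S_Suc Z_T L_Suc)
qed

lemma filterlim_L: "filterlim L at_top sequentially"
  by (rule filterlim_at_top_mono[OF filterlim_real_sequentially]) (simp add: L_ge)

lemma filterlim_L_Suc: "filterlim (\<lambda>j. L (Suc j)) at_top sequentially"
  using filterlim_L by (simp add: filterlim_sequentially_Suc)

text \<open>Necessity evaluates the frequency of zeros along the subsequences \<open>T j\<close> and
  \<open>S (Suc j)\<close>. Sufficiency squeezes it at every other position between two fractions in
  block sums.\<close>

lemma simply_normal_iff_blocks: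
  "simply_normal x \<longleftrightarrow> (\<lambda>j. L j / M j) \<longlonglongrightarrow> 1 \<and> (\<lambda>j. L (Suc j) / M j) \<longlonglongrightarrow> 1"
proof
  assume "simply_normal x"
  then have Z: "(\<lambda>n. Z n / real n) \<longlonglongrightarrow> 1/2" by (simp add: simply_normal_iff)
  have "(\<lambda>j. Z (T j) / real (T j)) \<longlonglongrightarrow> 1/2"
    using LIMSEQ_subseq_LIMSEQ[OF Z strict_mono_T] by (simp add: o_def)
  then have 1: "(\<lambda>j. L j / M j) \<longlonglongrightarrow> 1"
    by (simp only: Z_T Z_S real_T tendsto_half_iff_ratio[OF filterlim_L])
  have "strict_mono (\<lambda>j. S (Suc j))"
    unfolding strict_mono_Suc_iff using T_less_S S_less_T less_trans by blast
  from LIMSEQ_subseq_LIMSEQ[OF Z this]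
  have "(\<lambda>j. Z (S (Suc j)) / real (S (Suc j))) \<longlonglongrightarrow> 1/2" by (simp only: o_def)
  then have "(\<lambda>j. L (Suc j) / M j) \<longlonglongrightarrow> 1"
    by (simp only: Z_S real_S tendsto_half_iff_ratio[OF filterlim_L_Suc])
  with 1 show "(\<lambda>j. L j / M j) \<longlonglongrightarrow> 1 \<and> (\<lambda>j. L (Suc j) / M j) \<longlonglongrightarrow> 1" ..
next
  assume lim: "(\<lambda>j. L j / M j) \<longlonglongrightarrow> 1 \<and> (\<lambda>j. L (Suc j) / M j) \<longlonglongrightarrow> 1"
  have "(\<lambda>j. L (Suc j) / M (Suc j)) \<longlonglongrightarrow> 1"
    using lim filterlim_sequentially_Suc[of "\<lambda>j. L j / M j"] by simp
  \<comment> \<open>The lower squeeze pairs the fewest zeros with the most ones and so needs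
    \<open>L j / M (Suc j)\<close>, obtained here from three ratios with known limits.\<close>
  with lim have "(\<lambda>j. (L j / M j) * (L (Suc j) / M (Suc j)) / (L (Suc j) / M j)) \<longlonglongrightarrow> 1 * 1 / 1"
    by (intro tendsto_intros) auto
  moreover have "\<forall>\<^sub>F j in sequentially.
      (L j / M j) * (L (Suc j) / M (Suc j)) / (L (Suc j) / M j) = L j / M (Suc j)"
    using eventually_ge_at_top[of 1]
  proof eventually_elim
    case (elim j)
    then have "M j > 0" "L (Suc j) > 0" using M_ge[of j] L_ge[of "Suc j"] by simp_all
    then show ?case by simp
  qed
  ultimately have "(\<lambda>j. L j / M (Suc j)) \<longlonglongrightarrow> 1"
    by (simp add: tendsto_cong)
  then have lo: "(\<lambda>j. L j / (real (m 0) + L j + M (Suc j))) \<longlonglongrightarrow> 1/2"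
    by (simp only: tendsto_half_iff_ratio[OF filterlim_L])
  have hi: "(\<lambda>j. L (Suc j) / (real (m 0) + L (Suc j) + M j)) \<longlonglongrightarrow> 1/2"
    using lim by (simp only: tendsto_half_iff_ratio[OF filterlim_L_Suc])
  \<comment> \<open>\<open>J n\<close> will be the index of the interval between successive values
    of \<open>T\<close> that contains \<open>n\<close>.\<close>
  have "\<forall>n\<in>{T 0<..}. \<exists>j. T j < n \<and> n \<le> T (Suc j)"
    using ex_T_between[of 0] by (auto simp del: block_t.simps)
  then obtain J where J: "\<And>n. T 0 < n \<Longrightarrow> T (J n) < n \<and> n \<le> T (Suc (J n))"
    by (auto dest!: bchoice simp del: block_t.simps)
  have "filterlim J at_top sequentially"
    unfolding filterlim_at_top
  proof
    fix i
    show "\<forall>\<^sub>F n in sequentially. i \<le> J n"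
      using eventually_gt_at_top[of "T i"]
    proof eventually_elim
      case (elim n)
      then obtain j where j: "j \<ge> i" "T j < n" "n \<le> T (Suc j)" using ex_T_between by blast
      have "T 0 \<le> T i" by (simp only: strict_mono_less_eq[OF strict_mono_T] le0)
      then have "J n = j" using J[of n] elim j T_between_unique by (meson le_less_trans)
      then show ?case using j by simp
    qed
  qed
  note lims = filterlim_compose[OF lo this] filterlim_compose[OF hi this]
  have bounds: "L j / (real (m 0) + L j + M (Suc j)) \<le> Z n / real n \<and>
      Z n / real n \<le> L (Suc j) / (real (m 0) + L (Suc j) + M j)"
    if n: "T j < n" "n \<le> T (Suc j)" for n j
  proof -
    have z: "L j \<le> Z n" "Z n \<le> L (Suc j)"
      using Z_mono[of "T j" n] Z_mono[of n "T (Suc j)"] n unfolding Z_T Z_S by linarith+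
    have o: "real (m 0) + M j \<le> real n - Z n" "real n - Z n \<le> real (m 0) + M (Suc j)"
      using ones_mono[of "T j" n] ones_mono[of n "T (Suc j)"] n
      unfolding Z_T Z_S real_T by linarith+
    have nn: "0 \<le> L j" "0 \<le> M j" "0 < L (Suc j)" "0 < M (Suc j)" "0 < real n"
      using L_ge[of j] M_ge[of j] L_ge[of "Suc j"] M_ge[of "Suc j"] n by simp_all
    \<comment> \<open>A comparison \<open>a / (a + b) <= z / (z + w)\<close> with positive
      denominators reduces to \<open>a * w <= z * b\<close>.\<close>
    have "L j * (real n - Z n) \<le> Z n * (real (m 0) + M (Suc j))"
      by (rule mult_mono) (use z o nn M_ge[of "Suc j"] in auto)
    moreover have "Z n * (real (m 0) + M j) \<le> L (Suc j) * (real n - Z n)"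
      by (rule mult_mono) (use z o nn in auto)
    ultimately show ?thesis
      using nn by (simp add: divide_simps) (simp add: algebra_simps)
  qed
  have ev: "\<forall>\<^sub>F n in sequentially. T 0 < n" by (rule eventually_gt_at_top)
  have "(\<lambda>n. Z n / real n) \<longlonglongrightarrow> 1/2"
  proof (rule tendsto_sandwich[OF _ _ lims])
    show "\<forall>\<^sub>F n in sequentially. L (J n) / (real (m 0) + L (J n) + M (Suc (J n))) \<le> Z n / real n"
      using ev by eventually_elim (use J bounds in blast)
    show "\<forall>\<^sub>F n in sequentially. Z n / real n \<le> L (Suc (J n)) / (real (m 0) + L (Suc (J n)) + M (J n))"
      using ev by eventually_elim (use J bounds in blast)
  qed
  then show "simply_normal x" by (simp add: simply_normal_iff)
qed

section \<open>Conditions (ii) and (iii), and regularity\<close>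

lemma simply_normal_iff_zeros:
  "simply_normal x \<longleftrightarrow>
    (\<lambda>j. (\<Sum>u=1..j. real (l u)) / (\<Sum>u=1..j. real (m u))) \<longlonglongrightarrow> 1 \<and>
    (\<lambda>j. real (l j) / (\<Sum>u=1..j-1. real (l u))) \<longlonglongrightarrow> 0"
proof -
  \<comment> \<open>Given the first limit of (ii), the factor \<open>L j / M j\<close> of
    \<open>L (Suc j) / M j\<close> can be cancelled.\<close>
  have "(\<lambda>j. L (Suc j) / M j) \<longlonglongrightarrow> 1 \<longleftrightarrow> (\<lambda>j. L (Suc j) / L j) \<longlonglongrightarrow> 1"
    if lim: "(\<lambda>j. L j / M j) \<longlonglongrightarrow> 1"
  proof -
    have "\<forall>\<^sub>F j in sequentially. L (Suc j) / M j = L j / M j * (L (Suc j) / L j)"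
      using eventually_ge_at_top[of 1]
    proof eventually_elim
      case (elim j)
      then show ?case using L_ge[of j] by simp
    qed
    then show ?thesis by (simp only: tendsto_cong tendsto_mult_one_iff[OF lim])
  qed
  then show ?thesis
    using increment_ratio_iff[of l, OF l_ge_1] unfolding simply_normal_iff_blocks L_def M_def
    by blast
qed

lemma simply_normal_iff_ones:
  "simply_normal x \<longleftrightarrow>
    (\<lambda>j. (\<Sum>u=1..j. real (l u)) / (\<Sum>u=1..j. real (m u))) \<longlonglongrightarrow> 1 \<and>
    (\<lambda>j. real (m j) / (\<Sum>u=1..j-1. real (m u))) \<longlonglongrightarrow> 0"
proof -
  have "(\<lambda>j. L (Suc j) / M j) \<longlonglongrightarrow> 1 \<longleftrightarrow> (\<lambda>j. M (Suc j) / M j) \<longlonglongrightarrow> 1"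
    if "(\<lambda>j. L j / M j) \<longlonglongrightarrow> 1"
  proof -
    \<comment> \<open>The factor to cancel is now the shifted ratio, which leaves
      \<open>M (Suc j) / M j\<close>.\<close>
    have lim: "(\<lambda>j. L (Suc j) / M (Suc j)) \<longlonglongrightarrow> 1"
      using that filterlim_sequentially_Suc[of "\<lambda>j. L j / M j"] by simp
    have "M (Suc j) \<noteq> 0" for j using M_ge[of "Suc j"] by simp
    then have "L (Suc j) / M j = L (Suc j) / M (Suc j) * (M (Suc j) / M j)" for j
      by simp
    then show ?thesis using tendsto_mult_one_iff[OF lim, of "\<lambda>j. M (Suc j) / M j"] by presburger
  qed
  then show ?thesis
    using increment_ratio_iff[of m, OF m_ge_1] unfolding simply_normal_iff_blocks L_def M_def
    by blast
qed

text \<open>By (ii) and (iii), the ratio of a block to the preceding blocks of its own kind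
  converges and hence is bounded; the denominators in the definition of regularity are larger
  still.\<close>

lemma simply_normal_regular:
  assumes "simply_normal x"
  shows "regular_blocks l m"
proof -
  have "Bseq (\<lambda>j. real (l j) / L (j - 1))" "Bseq (\<lambda>j. real (m j) / M (j - 1))"
    using assms simply_normal_iff_zeros simply_normal_iff_ones
    by (auto simp: L_def M_def intro!: convergent_imp_Bseq convergentI)
  then obtain C D where CD: "C > 0" "\<And>j. \<bar>real (l j) / L (j - 1)\<bar> \<le> C"
    "\<And>j. \<bar>real (m j) / M (j - 1)\<bar> \<le> D"
    by (auto simp: Bseq_def)
  have "real (l j) / (L (j - 1) + M (j - 1)) \<le> max C D \<and>
      real (m j) / (L j + M (j - 1)) \<le> max C D"
    if j: "2 \<le> j" for j
  proof -
    have pos: "0 < L (j - 1)" "0 < M (j - 1)" "0 < L j"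
      using L_ge[of "j - 1"] M_ge[of "j - 1"] L_ge[of j] j by auto
    have "real (l j) / (L (j - 1) + M (j - 1)) \<le> real (l j) / L (j - 1)"
      "real (m j) / (L j + M (j - 1)) \<le> real (m j) / M (j - 1)"
      by (intro divide_left_mono; use pos in simp)+
    with CD(2,3)[of j] show ?thesis by linarith
  qed
  then show ?thesis
    unfolding regular_blocks_def L_def M_def
    by (intro exI[of _ "max C D"]) (use CD(1) in auto)
qed

section \<open>Birkhoff sums\<close>

definition birkhoff :: "real \<Rightarrow> nat \<Rightarrow> real" where
  "birkhoff p n = (\<Sum>k=1..n. 1 / orbit (k - 1) powr p)"

definition W :: "real \<Rightarrow> nat \<Rightarrow> real" where
  "W p j = (\<Sum>u=1..j. 2 powr (p * real (l u)))"

lemma W_Suc: "W p (Suc j) = W p j + 2 powr (p * real (l (Suc j)))"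
  by (simp add: W_def)

text \<open>After \<open>r\<close> doublings the orbit reaches some \<open>y\<close> in [1/2, 1), as
  the digit there is 1. Hence \<open>orbit k = y / 2 ^ r\<close>, and \<open>1 / y powr p\<close>
  lies between 1 and \<open>2 powr p\<close>.\<close>

lemma orbit_term_bounds:
  assumes p: "0 < p"
    and zeros: "\<And>i. i < r \<Longrightarrow> binary_digit x (Suc (k + i)) = 0"
    and one: "binary_digit x (Suc (k + r)) = 1"
  shows "2 powr (p * real r) \<le> 1 / orbit k powr p"
    and "1 / orbit k powr p \<le> 2 powr p * 2 powr (p * real r)"
proof -
  define y where "y = orbit (k + r)"
  have y: "1/2 \<le> y" "y < 1"
    using digit_zero_iff[of "k + r"] one orbit_less_1[of "k + r"] by (auto simp: y_def)
  have "y = 2 ^ r * orbit k" unfolding y_def by (rule orbit_zeros[OF zeros])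
  then have "orbit k = y / 2 powr real r" by (simp add: powr_realpow)
  then have eq: "1 / orbit k powr p = 2 powr (p * real r) * (1 / y powr p)"
    using y by (simp add: powr_divide powr_powr mult.commute)
  have "y powr p \<le> 1" using powr_mono2[of p y 1] p y by simp
  then have "1 \<le> 1 / y powr p" using y by simp
  then show "2 powr (p * real r) \<le> 1 / orbit k powr p"
    unfolding eq using mult_left_mono[of 1 "1 / y powr p" "2 powr (p * real r)"] by simp
  have "(1/2) powr p \<le> y powr p" using powr_mono2[of p "1/2" y] p y by simp
  then have "1 / y powr p \<le> 1 / (1/2) powr p" using y by (intro divide_left_mono) auto
  then have "1 / y powr p \<le> 2 powr p" by (simp add: powr_divide)
  then show "1 / orbit k powr p \<le> 2 powr p * 2 powr (p * real r)"
    unfolding eq using mult_left_mono[of "1 / y powr p" "2 powr p" "2 powr (p * real r)"]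
    by (simp add: mult.commute)
qed

lemma one_term_bounds:
  assumes "0 < p" "k \<in> {S j + 1..T j}"
  shows "1 \<le> 1 / orbit (k - 1) powr p" "1 / orbit (k - 1) powr p \<le> 2 powr p"
  using orbit_term_bounds[of p 0 "k - 1"] digit_one[OF assms(2)] assms by auto

text \<open>At offset \<open>i\<close> in the block, \<open>l (Suc j) - i\<close> zeros remain, and
  a one follows because the next block of ones is non-empty.\<close>

lemma zero_term_bounds:
  assumes p: "0 < p" and i: "i < l (Suc j)"
  shows "2 powr (p * real (l (Suc j) - i)) \<le> 1 / orbit (T j + i) powr p"
    and "1 / orbit (T j + i) powr p \<le> 2 powr p * 2 powr (p * real (l (Suc j) - i))"
proof -
  have zeros: "binary_digit x (Suc (T j + i + i')) = 0" if "i' < l (Suc j) - i" for i'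
    by (rule digit_zero[of _ j]) (use that in auto)
  have one: "binary_digit x (Suc (T j + i + (l (Suc j) - i))) = 1"
    by (rule digit_one[of _ "Suc j"]) (use m_ge_1[of "Suc j"] i in auto)
  from orbit_term_bounds[OF p zeros one]
  show "2 powr (p * real (l (Suc j) - i)) \<le> 1 / orbit (T j + i) powr p"
    and "1 / orbit (T j + i) powr p \<le> 2 powr p * 2 powr (p * real (l (Suc j) - i))"
    by simp_all
qed

section \<open>Birkhoff sums at block ends\<close>

lemma birkhoff_mono: "a \<le> b \<Longrightarrow> birkhoff p a \<le> birkhoff p b"
  unfolding birkhoff_def by (rule sum_mono2) auto

lemma birkhoff_ge:
  assumes "0 < p"
  shows "real n \<le> birkhoff p n"
proof -
  have "1 \<le> 1 / orbit k powr p" for k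
    using powr_mono2[of p "orbit k" 1] orbit_pos[of k] orbit_less_1[of k] assms by simp
  then have "(\<Sum>k=1..n. 1) \<le> birkhoff p n" unfolding birkhoff_def by (intro sum_mono)
  then show ?thesis by simp
qed

lemma birkhoff_S_Suc:
  assumes p: "0 < p"
  shows "birkhoff p (S (Suc j)) \<le> birkhoff p (T j) + zero_const p * 2 powr (p * real (l (Suc j)))"
proof -
  have "(\<Sum>k=T j+1..S (Suc j). 1 / orbit (k - 1) powr p) = (\<Sum>i<l (Suc j). 1 / orbit (T j + i) powr p)"
    by (rule sum.reindex_bij_witness[of _ "\<lambda>i. T j + i + 1" "\<lambda>k. k - T j - 1"]) auto
  also have "\<dots> \<le> (\<Sum>i<l (Suc j). 2 powr p * 2 powr (p * real (l (Suc j) - i)))"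
    by (rule sum_mono) (use zero_term_bounds(2)[OF p] in auto)
  also have "\<dots> \<le> zero_const p * 2 powr (p * real (l (Suc j)))"
    by (rule geometric_powr_bound[OF p])
  finally show ?thesis
    unfolding birkhoff_def using sum_atLeast1_split[OF less_imp_le[OF T_less_S]] by simp
qed

lemma birkhoff_T_bounds:
  assumes p: "0 < p"
  shows "birkhoff p (T j) \<le> birkhoff p (S j) + zero_const p * real (m j)"
    and "birkhoff p (S j) + real (m j) \<le> birkhoff p (T j)"
proof -
  have ST: "T j = S j + m j" by (cases j) simp_all
  have "birkhoff p (T j) = birkhoff p (S j) + (\<Sum>k=S j+1..T j. 1 / orbit (k - 1) powr p)"
    unfolding birkhoff_def by (rule sum_atLeast1_split) (simp add: ST)
  moreover have "(\<Sum>k=S j+1..T j. 1 / orbit (k - 1) powr p) \<le> (\<Sum>k=S j+1..T j. zero_const p)"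
    by (rule sum_mono) (use one_term_bounds(2)[OF p] zero_const_ge[OF p] order_trans in blast)
  moreover have "(\<Sum>k=S j+1..T j. 1) \<le> (\<Sum>k=S j+1..T j. 1 / orbit (k - 1) powr p)"
    by (rule sum_mono) (use one_term_bounds(1)[OF p] in blast)
  ultimately show "birkhoff p (T j) \<le> birkhoff p (S j) + zero_const p * real (m j)"
    and "birkhoff p (S j) + real (m j) \<le> birkhoff p (T j)"
    by (simp_all add: ST mult.commute)
qed

text \<open>The first zero of a block alone yields the full power; this serves the lower bound when
  \<open>n\<close> lies inside the block.\<close>

lemma birkhoff_Suc_T:
  assumes p: "0 < p"
  shows "birkhoff p (T j) + 2 powr (p * real (l (Suc j))) \<le> birkhoff p (Suc (T j))"
  using zero_term_bounds(1)[OF p, of 0 j] l_ge_1[of "Suc j"] by (simp add: birkhoff_def)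

lemma birkhoff_lower:
  assumes p: "0 < p"
  shows "W p j + M j \<le> birkhoff p (T j)"
proof (induction j)
  case 0
  then show ?case by (simp add: W_def birkhoff_def sum_nonneg)
next
  case (Suc j)
  have "birkhoff p (Suc (T j)) \<le> birkhoff p (S (Suc j))"
    by (rule birkhoff_mono) (use T_less_S[of j] in linarith)
  with Suc birkhoff_Suc_T[OF p, of j] birkhoff_T_bounds(2)[OF p, of "Suc j"] show ?case
    unfolding W_Suc M_Suc by linarith
qed

text \<open>The summand \<open>m 0\<close> stands for the leading ones, which the numerator of
  \<open>Phi2\<close> omits; a constant absorbs it later.\<close>

lemma birkhoff_upper:
  assumes p: "0 < p"
  shows "birkhoff p (T j) \<le> zero_const p * (real (m 0) + W p j + M j)"
proof (induction j)
  case 0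
  then show ?case using birkhoff_T_bounds(1)[OF p, of 0] by (simp add: W_def birkhoff_def)
next
  case (Suc j)
  with birkhoff_S_Suc[OF p, of j] birkhoff_T_bounds(1)[OF p, of "Suc j"] show ?case
    unfolding W_Suc M_Suc distrib_left by linarith
qed

lemma W_ge:
  assumes p: "0 < p"
  shows "real j \<le> W p j" "L j \<le> max 1 (1 / (p * ln 2)) * W p j"
proof -
  have "1 \<le> 2 powr (p * real (l u))" for u using p by (simp add: ge_one_powr_ge_zero)
  then have "(\<Sum>u=1..j. 1) \<le> W p j" unfolding W_def by (intro sum_mono)
  then show "real j \<le> W p j" by simp
  \<comment> \<open>Linear growth is beaten by the exponential through \<open>t <= exp t\<close>.
    The maximum with 1 lets the same constant serve for the ones.\<close>
  have "real n \<le> max 1 (1 / (p * ln 2)) * 2 powr (p * real n)" for n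
  proof -
    have "p * real n * ln 2 \<le> exp (p * real n * ln 2)"
      using exp_ge_add_one_self[of "p * real n * ln 2"] by linarith
    then have "p * real n * ln 2 \<le> 2 powr (p * real n)" by (simp add: powr_def)
    then have "real n \<le> 1 / (p * ln 2) * 2 powr (p * real n)"
      using p by (simp add: field_simps)
    also have "\<dots> \<le> max 1 (1 / (p * ln 2)) * 2 powr (p * real n)"
      by (rule mult_right_mono) auto
    finally show ?thesis .
  qed
  then show "L j \<le> max 1 (1 / (p * ln 2)) * W p j"
    unfolding L_def W_def sum_distrib_left by (intro sum_mono)
qed

section \<open>Values of \<open>Phi2\<close> and the comparison with Birkhoff averages\<close>

lemma Phi2_initial:
  assumes "1 \<le> n" "n \<le> T 1"
  shows "Phi2 p l m n = 1"
proof -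
  have "n \<in> one_positions l m 0 \<union> zero_positions l m 1 \<union> one_positions l m 1"
    using assms by (auto simp: one_positions_def zero_positions_def)
  then show ?thesis by (simp add: Phi2_def)
qed

text \<open>Disjointness of the intervals between values of \<open>T\<close> makes the index under
  \<open>THE\<close> unique. It is \<open>Suc j\<close>, so \<open>1 <= j\<close> means being past
  the positions where \<open>Phi2\<close> is set to 1.\<close>

lemma Phi2_zero_block:
  assumes "1 \<le> j" "T j < n" "n \<le> S (Suc j)"
  shows "Phi2 p l m n = (W p (Suc j) + M j) / (L (Suc j) + M j)"
proof -
  have mono: "T 0 \<le> T j" "T 1 \<le> T j"
    using assms(1) by (simp_all only: strict_mono_less_eq[OF strict_mono_T])
  have T1: "S 1 \<le> T 1" using S_less_T[of 0] by simp
  have nT: "n \<le> T (Suc j)" using assms S_less_T[of j] by linarith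
  have "n \<notin> one_positions l m 0 \<union> zero_positions l m 1 \<union> one_positions l m 1"
    using assms(2) mono T1 unfolding one_positions_def zero_positions_def
    by (auto simp del: block_s.simps block_t.simps)
  moreover have ex: "2 \<le> Suc j \<and> n \<in> zero_positions l m (Suc j)"
    using assms by (simp add: zero_positions_def)
  moreover have "i = Suc j" if i2: "2 \<le> i \<and> n \<in> zero_positions l m i" for i
  proof -
    obtain i' where i: "i = Suc i'" using i2 by (cases i) simp_all
    then have "T i' < n" "n \<le> T (Suc i')"
      using i2 by (auto simp: zero_positions_def)
    then show ?thesis using T_between_unique[OF _ _ assms(2) nT] i by blast
  qed
  then have "(THE i. 2 \<le> i \<and> n \<in> zero_positions l m i) = Suc j"
    using ex by (intro the_equality)
  ultimately show ?thesis
    unfolding Phi2_def W_def L_def M_def by (simp only: if_False if_True Let_def diff_Suc_1) (metis)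
qed

lemma Phi2_one_block:
  assumes "1 \<le> j" "S (Suc j) < n" "n \<le> T (Suc j)"
  shows "Phi2 p l m n = (W p (Suc j) + M j) / (L (Suc j) + M (Suc j))"
proof -
  have mono: "T 0 \<le> T j" "T 1 \<le> T j"
    using assms(1) by (simp_all only: strict_mono_less_eq[OF strict_mono_T])
  have T1: "S 1 \<le> T 1" using S_less_T[of 0] by simp
  have nT: "T j < n" using assms T_less_S[of j] by linarith
  have "n \<notin> one_positions l m 0 \<union> zero_positions l m 1 \<union> one_positions l m 1"
    using nT mono T1 unfolding one_positions_def zero_positions_def
    by (auto simp del: block_s.simps block_t.simps)
  moreover have "\<not> (\<exists>i\<ge>2. n \<in> zero_positions l m i)"
  proof
    assume "\<exists>i\<ge>2. n \<in> zero_positions l m i"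
    then obtain i where i: "2 \<le> i" "n \<in> zero_positions l m i" by blast
    obtain i' where i': "i = Suc i'" using i by (cases i) simp_all
    then have *: "T i' < n" "n \<le> S (Suc i')"
      using i by (auto simp: zero_positions_def)
    then have "n \<le> T (Suc i')" using S_less_T[of i'] by linarith
    then have "i' = j" using T_between_unique[OF *(1) _ nT assms(3)] by blast
    with * assms show False by simp
  qed
  moreover have ex: "2 \<le> Suc j \<and> n \<in> one_positions l m (Suc j)"
    using assms by (simp add: one_positions_def)
  moreover have "i = Suc j" if i2: "2 \<le> i \<and> n \<in> one_positions l m i" for i
  proof -
    obtain i' where i: "i = Suc i'" using i2 by (cases i) simp_all
    then have "T i' < n" "n \<le> T (Suc i')"
      using i2 by (auto simp: one_positions_def)
    then show ?thesis using T_between_unique[OF _ _ nT assms(3)] i by blast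
  qed
  then have "(THE i. 2 \<le> i \<and> n \<in> one_positions l m i) = Suc j"
    using ex by (intro the_equality)
  ultimately show ?thesis
    unfolding Phi2_def W_def L_def M_def by (simp only: if_False if_True Let_def diff_Suc_1)
qed

lemma birkhoff_comparable:
  assumes p: "0 < p" and reg: "regular_blocks l m"
  shows "\<exists>d\<^sub>1>0. \<exists>d\<^sub>2>0. \<forall>n\<ge>1.
    d\<^sub>1 * Phi2 p l m n \<le> birkhoff p n / real n \<and> birkhoff p n / real n \<le> d\<^sub>2 * Phi2 p l m n"
proof -
  obtain C where C: "C > 0"
    and lC: "\<And>j. 1 \<le> j \<Longrightarrow> real (l (Suc j)) \<le> C * (L j + M j)"
    and mC: "\<And>j. 1 \<le> j \<Longrightarrow> real (m (Suc j)) \<le> C * (L (Suc j) + M j)"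
  proof -
    from reg obtain C where C: "C > 0" and b: "\<And>j. j \<ge> 2 \<Longrightarrow>
        max (real (l j) / (L (j - 1) + M (j - 1))) (real (m j) / (L j + M (j - 1))) \<le> C"
      unfolding regular_blocks_def L_def M_def by blast
    have "real (l (Suc j)) \<le> C * (L j + M j) \<and> real (m (Suc j)) \<le> C * (L (Suc j) + M j)"
      if "1 \<le> j" for j
      using b[of "Suc j"] that L_ge[of j] M_ge[of j] L_ge[of "Suc j"] by (simp add: divide_le_eq)
    with C show ?thesis by (intro that) auto
  qed
  \<comment> \<open>\<open>b\<close> compares lengths with powers, \<open>c\<close> absorbs the
    leading ones, and \<open>Q\<close> collects these with the last block of ones, controlled by
    regularity.\<close>
  define b where "b = max 1 (1 / (p * ln 2))"
  define c where "c = 1 + real (m 0)"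
  define Q where "Q = zero_const p * (c + C * b)"
  have b: "1 \<le> b" by (simp add: b_def)
  have c: "1 \<le> c" by (simp add: c_def)
  have zc: "1 \<le> zero_const p" by (rule zero_const_ge(2)[OF p])
  have "1 * 1 \<le> Q"
    unfolding Q_def by (rule mult_mono) (use zc c b C in \<open>auto intro: add_increasing2\<close>)
  then have Q: "0 < Q" by simp
  define B where "B = birkhoff p (T 1)"
  have T1: "1 \<le> T 1" using l_ge_1[of 1] by simp
  have B: "0 < B" using birkhoff_ge[OF p, of "T 1"] T1 by (simp add: B_def)
  have main: "1 / c * Phi2 p l m n \<le> birkhoff p n / real n \<and>
      birkhoff p n / real n \<le> Q * (1 + C) * Phi2 p l m n" if n: "T 1 < n" for n
  proof -
    obtain j where j: "1 \<le> j" "T j < n" "n \<le> T (Suc j)" using ex_T_between[OF n] by blast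
    \<comment> \<open>\<open>N\<close> is the numerator in both branches of \<open>Phi2\<close>;
      \<open>E\<close> is the denominator in a block of zeros, and \<open>F\<close> below the one in
      a block of ones.\<close>
    define N where "N = W p (Suc j) + M j"
    define E where "E = L (Suc j) + M j"
    have j1: "1 \<le> real j" using j by simp
    have N1: "1 \<le> N" using W_ge(1)[OF p, of "Suc j"] M_ge[of j] j1 by (simp add: N_def)
    have E1: "1 \<le> E" using L_ge[of "Suc j"] M_ge[of j] j1 by (simp add: E_def)
    have EN: "E \<le> b * N"
    proof -
      have "M j \<le> b * M j" using b M_ge[of j] mult_right_mono[of 1 b "M j"] by simp
      then show ?thesis using W_ge(2)[OF p, of "Suc j"] by (simp add: E_def N_def b_def distrib_left)
    qed
    have E_le: "E \<le> (1 + C) * (L j + M j)" using lC[OF j(1)] by (simp add: E_def L_Suc algebra_simps)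
    have Tn: "L j + M j \<le> real n" using real_T[of j] j(2) by linarith
    have low: "N \<le> birkhoff p n"
    proof -
      have "N \<le> birkhoff p (Suc (T j))"
        using birkhoff_lower[OF p, of j] birkhoff_Suc_T[OF p, of j] by (simp add: N_def W_Suc)
      also have "\<dots> \<le> birkhoff p n" by (rule birkhoff_mono) (use j in simp)
      finally show ?thesis .
    qed
    have mN: "real (m 0) + N \<le> c * N"
      using N1 mult_left_mono[of 1 N "real (m 0)"] by (simp add: c_def distrib_right)
    \<comment> \<open>The sum is extended to the end \<open>T (Suc j)\<close>; regularity bounds the
      last block of ones by \<open>C * E\<close>, hence by \<open>C * (b * N)\<close>.\<close>
    have up: "birkhoff p n \<le> Q * N"
    proof -
      have "C * E \<le> C * (b * N)" using EN C by (intro mult_left_mono) auto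
      then have "real (m 0) + W p (Suc j) + M (Suc j) \<le> (c + C * b) * N"
        using mN mC[OF j(1)] by (simp add: N_def E_def M_Suc algebra_simps)
      then have "zero_const p * (real (m 0) + W p (Suc j) + M (Suc j)) \<le> zero_const p * ((c + C * b) * N)"
        using zc by (intro mult_left_mono) auto
      then have "birkhoff p (T (Suc j)) \<le> Q * N"
        using birkhoff_upper[OF p, of "Suc j"] by (simp only: Q_def mult.assoc)
      then show ?thesis using birkhoff_mono[OF j(3), of p] by linarith
    qed
    have np: "0 < real n" using j by simp
    show ?thesis
    proof (cases "n \<le> S (Suc j)")
      case True
      \<comment> \<open>The block of zeros containing \<open>n\<close> is at most \<open>C\<close>
        times what precedes it, so counting it whole keeps \<open>E\<close> comparable to
        \<open>n\<close>.\<close>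
      have "E \<le> (1 + C) * real n"
        using E_le Tn C mult_left_mono[OF Tn, of "1 + C"] by linarith
      moreover have "real n \<le> c * E"
        using True real_S[of j] E1 mult_left_mono[of 1 E "real (m 0)"]
        by (simp add: c_def E_def distrib_right del: block_s.simps)
      ultimately have "1 / c * (N / E) \<le> birkhoff p n / real n \<and> birkhoff p n / real n \<le> Q * (1 + C) * (N / E)"
        using ratio_comparison[of "real n" E c "1 + C" N "birkhoff p n" Q] np E1 c C N1 low up by simp
      then show ?thesis using Phi2_zero_block[OF j(1,2) True] by (simp only: N_def E_def)
    next
      case False
      define F where "F = L (Suc j) + M (Suc j)"
      have Fp: "E \<le> F" by (simp add: E_def F_def M_Suc)
      have F_le: "F \<le> (1 + C) * E" using mC[OF j(1)] by (simp add: E_def F_def M_Suc algebra_simps)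
      have En: "E \<le> real n" using False real_S[of j] by (simp add: E_def del: block_s.simps)
      have "F \<le> (1 + C) * real n"
        using F_le mult_left_mono[OF En, of "1 + C"] C by linarith
      moreover have "real n \<le> c * F"
      proof -
        have "real n \<le> real (m 0) + F" using j(3) real_T[of "Suc j"] by (simp add: F_def del: block_t.simps)
        then show ?thesis using Fp E1 mult_left_mono[of 1 F "real (m 0)"] by (simp add: c_def distrib_right)
      qed
      ultimately have "1 / c * (N / F) \<le> birkhoff p n / real n \<and> birkhoff p n / real n \<le> Q * (1 + C) * (N / F)"
        using ratio_comparison[of "real n" F c "1 + C" N "birkhoff p n" Q] np E1 Fp c C N1 low up by simp
      moreover have "S (Suc j) < n" using False by simp
      ultimately show ?thesis using Phi2_one_block[OF j(1) _ j(3)] by (simp only: N_def F_def)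
    qed
  qed
  have init: "1 / c * Phi2 p l m n \<le> birkhoff p n / real n \<and> birkhoff p n / real n \<le> B * Phi2 p l m n"
    if n: "1 \<le> n" "n \<le> T 1" for n
  proof -
    have "1 \<le> birkhoff p n / real n" using birkhoff_ge[OF p, of n] n by simp
    moreover have "1 / c \<le> 1" using c by simp
    moreover have "birkhoff p n / real n \<le> B / 1"
      by (rule frac_le) (use n B birkhoff_mono[OF n(2), of p] in \<open>auto simp: B_def\<close>)
    ultimately show ?thesis using Phi2_initial[OF n, of p] by simp
  qed
  have "1 / c * Phi2 p l m n \<le> birkhoff p n / real n \<and>
      birkhoff p n / real n \<le> max B (Q * (1 + C)) * Phi2 p l m n" if n: "1 \<le> n" for n
  proof -
    have *: "1 / c * Phi2 p l m n \<le> birkhoff p n / real n"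
      "birkhoff p n / real n \<le> B * Phi2 p l m n \<or> birkhoff p n / real n \<le> Q * (1 + C) * Phi2 p l m n"
      using main[of n] init[OF n] by (cases "n \<le> T 1"; force)+
    \<comment> \<open>Enlarging the constant to the maximum needs \<open>Phi2\<close> to be
      non-negative, which holds since a positive average is at most a positive multiple of
      it.\<close>
    have "0 < birkhoff p n / real n" using birkhoff_ge[OF p, of n] n by simp
    with *(2) B Q C have "0 \<le> Phi2 p l m n"
      by (smt (verit) mult_pos_pos mult_pos_neg)
    then have "B * Phi2 p l m n \<le> max B (Q * (1 + C)) * Phi2 p l m n"
      "Q * (1 + C) * Phi2 p l m n \<le> max B (Q * (1 + C)) * Phi2 p l m n"
      by (intro mult_right_mono; simp)+
    with * show ?thesis by linarith
  qed
  moreover have "0 < 1 / c" "0 < max B (Q * (1 + C))" using c B by auto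
  ultimately show ?thesis by blast
qed

end

theorem theorem4p2:
  fixes x :: real and l m :: "nat \<Rightarrow> nat"
  assumes "x \<in> Sigma_set"
    and "block_decomposition x l m"
  shows
    "(simply_normal x \<longleftrightarrow>
        (\<lambda>j. (\<Sum>u=1..j. real (l u)) / (\<Sum>u=1..j. real (m u))) \<longlonglongrightarrow> 1 \<and>
        (\<lambda>j. real (l j) / (\<Sum>u=1..j-1. real (l u))) \<longlonglongrightarrow> 0) \<and>
     (simply_normal x \<longleftrightarrow>
        (\<lambda>j. (\<Sum>u=1..j. real (l u)) / (\<Sum>u=1..j. real (m u))) \<longlonglongrightarrow> 1 \<and>
        (\<lambda>j. real (m j) / (\<Sum>u=1..j-1. real (m u))) \<longlonglongrightarrow> 0) \<and>
     (simply_normal x \<longrightarrow> regular_blocks l m) \<and>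
     (\<forall>p::real. p > 0 \<and> simply_normal x \<longrightarrow>
        (\<exists>d\<^sub>1>0. \<exists>d\<^sub>2>0. \<forall>n\<ge>1.
           d\<^sub>1 * Phi2 p l m n \<le> (1 / real n) * (\<Sum>k=1..n. 1 / ((doubling_map ^^ (k - 1)) x) powr p) \<and>
           (1 / real n) * (\<Sum>k=1..n. 1 / ((doubling_map ^^ (k - 1)) x) powr p) \<le> d\<^sub>2 * Phi2 p l m n))"
proof -
  interpret block_decomposed x l m by unfold_locales fact+
  have "simply_normal x \<Longrightarrow> 0 < p \<Longrightarrow> \<exists>d\<^sub>1>0. \<exists>d\<^sub>2>0. \<forall>n\<ge>1.
      d\<^sub>1 * Phi2 p l m n \<le> (1 / real n) * (\<Sum>k=1..n. 1 / ((doubling_map ^^ (k - 1)) x) powr p) \<and>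
      (1 / real n) * (\<Sum>k=1..n. 1 / ((doubling_map ^^ (k - 1)) x) powr p) \<le> d\<^sub>2 * Phi2 p l m n" for p
    using birkhoff_comparable[of p] simply_normal_regular
    by (simp only: birkhoff_def divide_inverse mult.commute mult_1_left)
  then show ?thesis
    using simply_normal_iff_zeros simply_normal_iff_ones simply_normal_regular by blast
qed

end
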